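(* Let $k,\rho,c,\lambda,\Theta_\infty,h>0$ be constants and set $\alpha=\frac{k}{\rho c}$, $\mathrm{Ste}=\frac{c\Theta_\infty}{\lambda}$, $\mathrm{Bi}=\frac{h\sqrt{\alpha}}{k}$. Put $$\xi^{\min}=\frac{\sqrt{4\mathrm{Ste}^2+8\mathrm{Ste}+\frac{1}{\mathrm{Bi}^2}}-\frac{1}{\mathrm{Bi}}}{2(2+\mathrm{Ste})},\qquad \xi^{\max}=\frac{\sqrt{12\mathrm{Ste}^2+36\mathrm{Ste}+\frac{9}{\mathrm{Bi}^2}}-\frac{3}{\mathrm{Bi}}}{2(3+\mathrm{Ste})}.$$ Then the polynomial equation $$\left(12+9\mathrm{Ste}+2\mathrm{Ste}^{2}\right)z^{4}+\tfrac{21+6\mathrm{Ste}}{\mathrm{Bi}}z^{3}+\left(\tfrac{12}{\mathrm{Bi}^{2}}-42\mathrm{Ste}-12\mathrm{Ste}^{2}-18\right)z^{2}-\tfrac{30\mathrm{Ste}+9}{\mathrm{Bi}}z+9\mathrm{Ste}\left(1+2\mathrm{Ste}\right)=0$$ has exactly one solution $z=\xi_1$ in the interval $\xi^{\min}<z<\xi^{\max}$; the constants $$A_{1}=\frac{6\mathrm{Ste}-(6+2\mathrm{Ste})\xi_{1}^{2}-\frac{6}{\mathrm{Bi}}\xi_{1}}{\mathrm{Ste}\left(\xi_{1}^{2}+\frac{2}{\mathrm{Bi}}\xi_{1}+3\right)},\qquad B_{1}=\frac{(3\mathrm{Ste}+6)\xi_{1}^{2}+\frac{3}{\mathrm{Bi}}\xi_{1}-3\mathrm{Ste}}{\mathrm{Ste}\left(\xi_{1}^{2}+\frac{2}{\mathrm{Bi}}\xi_{1}+3\right)}$$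 are positive; and the (unique) solution of Problem (P1) for a quadratic profile in space is $$T_{1}(x,t)=-A_{1}\Theta_{\infty}\left(1-\frac{x}{s_{1}(t)}\right)-B_{1}\Theta_{\infty}\left(1-\frac{x}{s_{1}(t)}\right)^{2},\qquad s_{1}(t)=2\xi_{1}\sqrt{\alpha t}.$$
   Context: Problem (P1): find $s_1=s_1(t)$ and $T_1=T_1(x,t)$, defined for $0\le x\le s_1(t)$, $t>0$, such that - $\dfrac{d}{dt}\displaystyle\int_{0}^{s_{1}(t)}T_{1}(x,t)\,dx=\dfrac{k}{\rho c}\left[\dfrac{\rho\lambda}{k}\dot{s}_{1}(t)-\dfrac{\partial T_1}{\partial x}(0,t)\right]$, $t>0$; - $k\dfrac{\partial T_1}{\partial x}(0,t)=\dfrac{h}{\sqrt{t}}\left(T_{1}(0,t)+\Theta_{\infty}\right)$, $t>0$; - $T_{1}(s_{1}(t),t)=0$, $t>0$; - $\left(\dfrac{\partial T_1}{\partial x}(s_{1}(t),t)\right)^2=-\dfrac{\lambda}{c}\dfrac{\partial^2 T_1}{\partial x^2}(s_{1}(t),t)$, $t>0$; - $s_{1}(0)=0$. A solution "for a quadratic profile in space" is a solution pair $(T_1,s_1)$ in which $T_1(x,t)=-A\Theta_\infty\left(1-\frac{x}{s_1(t)}\right)-B\Theta_\infty\left(1-\frac{x}{s_1(t)}\right)^2$ for some constants $A>0$, $B>0$, with $s_1$ continuous on $[0,\infty)$, continuously differentiable and positive on $(0,\infty)$. *)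

theory Defs
  imports "HOL-Analysis.Analysis"
begin

text \<open>
  Only the values \<open>T x t\<close> with \<open>t > 0\<close>, \<open>0 \<le> x \<le> s t\<close> matter. Spatial derivatives are
  taken relative to \<open>{0..s t}\<close>, hence are one-sided at \<open>x = 0\<close> and \<open>x = s t\<close>; they are
  uniquely determined as soon as \<open>s t > 0\<close>.
\<close>

definition P1_solution ::
  "real \<Rightarrow> real \<Rightarrow> real \<Rightarrow> real \<Rightarrow> real \<Rightarrow> real \<Rightarrow> (real \<Rightarrow> real \<Rightarrow> real) \<Rightarrow> (real \<Rightarrow> real) \<Rightarrow> bool"
where
  "P1_solution k \<rho> c lam \<Theta> h T s \<longleftrightarrow>
     (\<exists>Tx Txx :: real \<Rightarrow> real \<Rightarrow> real.
        (\<forall>t>0. \<forall>x\<in>{0..s t}.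
           ((\<lambda>y. T y t) has_real_derivative Tx x t) (at x within {0..s t}) \<and>
           ((\<lambda>y. Tx y t) has_real_derivative Txx x t) (at x within {0..s t})) \<and>
        (\<forall>t>0. s differentiable at t \<and>
           ((\<lambda>\<tau>. integral {0..s \<tau>} (\<lambda>x. T x \<tau>)) has_real_derivative
              (k / (\<rho> * c)) * ((\<rho> * lam / k) * deriv s t - Tx 0 t)) (at t)) \<and>
        (\<forall>t>0. k * Tx 0 t = (h / sqrt t) * (T 0 t + \<Theta>)) \<and>
        (\<forall>t>0. T (s t) t = 0) \<and>
        (\<forall>t>0. (Tx (s t) t)\<^sup>2 = - (lam / c) * Txx (s t) t) \<and>
        s 0 = 0)"

definition quadratic_profile ::
  "real \<Rightarrow> real \<Rightarrow> real \<Rightarrow> (real \<Rightarrow> real) \<Rightarrow> real \<Rightarrow> real \<Rightarrow> real"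
where
  "quadratic_profile A B \<Theta> s x t = - A * \<Theta> * (1 - x / s t) - B * \<Theta> * (1 - x / s t)\<^sup>2"

definition P1_quadratic_solution ::
  "real \<Rightarrow> real \<Rightarrow> real \<Rightarrow> real \<Rightarrow> real \<Rightarrow> real \<Rightarrow> (real \<Rightarrow> real \<Rightarrow> real) \<Rightarrow> (real \<Rightarrow> real) \<Rightarrow> bool"
where
  "P1_quadratic_solution k \<rho> c lam \<Theta> h T s \<longleftrightarrow>
     P1_solution k \<rho> c lam \<Theta> h T s \<and>
     (\<exists>A>0. \<exists>B>0. \<forall>t>0. \<forall>x\<in>{0..s t}. T x t = quadratic_profile A B \<Theta> s x t) \<and>
     continuous_on {0..} s \<and>
     (\<forall>t>0. s differentiable at t) \<and> continuous_on {0<..} (deriv s) \<and>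
     (\<forall>t>0. s t > 0)"

definition xi_min :: "real \<Rightarrow> real \<Rightarrow> real" where
  "xi_min Ste Bi = (sqrt (4 * Ste\<^sup>2 + 8 * Ste + 1 / Bi\<^sup>2) - 1 / Bi) / (2 * (2 + Ste))"

definition xi_max :: "real \<Rightarrow> real \<Rightarrow> real" where
  "xi_max Ste Bi = (sqrt (12 * Ste\<^sup>2 + 36 * Ste + 9 / Bi\<^sup>2) - 3 / Bi) / (2 * (3 + Ste))"

definition xi_quartic :: "real \<Rightarrow> real \<Rightarrow> real \<Rightarrow> real" where
  "xi_quartic Ste Bi z =
     (12 + 9 * Ste + 2 * Ste\<^sup>2) * z ^ 4 + ((21 + 6 * Ste) / Bi) * z ^ 3
     + (12 / Bi\<^sup>2 - 42 * Ste - 12 * Ste\<^sup>2 - 18) * z\<^sup>2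
     - ((30 * Ste + 9) / Bi) * z + 9 * Ste * (1 + 2 * Ste)"

definition coeff_A1 :: "real \<Rightarrow> real \<Rightarrow> real \<Rightarrow> real" where
  "coeff_A1 Ste Bi \<xi> =
     (6 * Ste - (6 + 2 * Ste) * \<xi>\<^sup>2 - (6 / Bi) * \<xi>) / (Ste * (\<xi>\<^sup>2 + (2 / Bi) * \<xi> + 3))"

definition coeff_B1 :: "real \<Rightarrow> real \<Rightarrow> real \<Rightarrow> real" where
  "coeff_B1 Ste Bi \<xi> =
     ((3 * Ste + 6) * \<xi>\<^sup>2 + (3 / Bi) * \<xi> - 3 * Ste) / (Ste * (\<xi>\<^sup>2 + (2 / Bi) * \<xi> + 3))"

end

theory Submission imports Defs begin

text \<open>
  For a quadratic profile the convective condition at \<open>x = 0\<close> forces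
  \<open>s t = 2 \<xi> sqrt (\<alpha> t)\<close>, and (P1) becomes three algebraic equations in \<open>A\<close>, \<open>B\<close>, \<open>\<xi>\<close>:
  two of them are linear in \<open>A\<close>, \<open>B\<close> and give \<open>A\<^sub>1\<close>, \<open>B\<^sub>1\<close>, the third is
  \<open>Ste A\<^sup>2 = 2 B\<close>. With \<open>A\<^sub>1 = N\<^sub>A / D\<close> and \<open>B\<^sub>1 = N\<^sub>B / D\<close> the latter reads
  \<open>N\<^sub>A\<^sup>2 = 2 N\<^sub>B D / Ste\<close>, which is the quartic. Moreover \<open>A\<^sub>1 > 0\<close> iff \<open>\<xi> < xi_max\<close>
  and \<open>B\<^sub>1 > 0\<close> iff \<open>\<xi> > xi_min\<close>. Between these bounds \<open>N\<^sub>A\<close> is positive and decreasing while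
  \<open>N\<^sub>B\<close> and \<open>D\<close> are increasing, so the quartic is strictly decreasing; it is
  positive at \<open>xi_min\<close>, where \<open>N\<^sub>B = 0\<close>, and negative at \<open>xi_max\<close>, where \<open>N\<^sub>A = 0\<close>.
\<close>

section \<open>Signs of a quadratic around its positive root\<close>

text \<open>Completing the square: \<open>(2 * a * z + b)^2\<close> exceeds the discriminant by
  \<open>4 * a\<close> times the quadratic, and \<open>2 * a * z + b\<close> is its own square root
  because it is positive. \<open>sqrt\<close> is strictly increasing on all reals, so comparing
  radicands also covers a negative discriminant.\<close>

lemma less_positive_root_iff:
  fixes a b e z :: real
  assumes "a > 0" "b \<ge> 0" "z > 0"
  shows "z < (sqrt (b\<^sup>2 + 4 * a * e) - b) / (2 * a) \<longleftrightarrow> a * z\<^sup>2 + b * z - e < 0"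
    and "(sqrt (b\<^sup>2 + 4 * a * e) - b) / (2 * a) < z \<longleftrightarrow> a * z\<^sup>2 + b * z - e > 0"
proof -
  have sq: "(2 * a * z + b)\<^sup>2 = b\<^sup>2 + 4 * a * e + 4 * a * (a * z\<^sup>2 + b * z - e)"
    by (simp add: power2_eq_square algebra_simps)
  have rt: "sqrt ((2 * a * z + b)\<^sup>2) = 2 * a * z + b"
    using assms by simp
  have "z < (sqrt (b\<^sup>2 + 4 * a * e) - b) / (2 * a) \<longleftrightarrow> sqrt ((2 * a * z + b)\<^sup>2) < sqrt (b\<^sup>2 + 4 * a * e)"
    unfolding rt using assms by (simp add: pos_less_divide_eq algebra_simps)
  also have "\<dots> \<longleftrightarrow> 4 * a * (a * z\<^sup>2 + b * z - e) < 0"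
    by (simp only: real_sqrt_less_iff sq) linarith
  also have "\<dots> \<longleftrightarrow> a * z\<^sup>2 + b * z - e < 0"
    using assms by (simp add: mult_less_0_iff)
  finally show "z < (sqrt (b\<^sup>2 + 4 * a * e) - b) / (2 * a) \<longleftrightarrow> a * z\<^sup>2 + b * z - e < 0" .
  have "(sqrt (b\<^sup>2 + 4 * a * e) - b) / (2 * a) < z \<longleftrightarrow> sqrt (b\<^sup>2 + 4 * a * e) < sqrt ((2 * a * z + b)\<^sup>2)"
    unfolding rt using assms by (simp add: pos_divide_less_eq algebra_simps)
  also have "\<dots> \<longleftrightarrow> 4 * a * (a * z\<^sup>2 + b * z - e) > 0"
    by (simp only: real_sqrt_less_iff sq) linarith
  also have "\<dots> \<longleftrightarrow> a * z\<^sup>2 + b * z - e > 0"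
    using assms by (simp add: zero_less_mult_iff)
  finally show "(sqrt (b\<^sup>2 + 4 * a * e) - b) / (2 * a) < z \<longleftrightarrow> a * z\<^sup>2 + b * z - e > 0" .
qed

section \<open>Numerators and denominator of the two coefficients\<close>

definition num_A :: "real \<Rightarrow> real \<Rightarrow> real \<Rightarrow> real" where
  "num_A Ste Bi z = 6 * Ste - (6 + 2 * Ste) * z\<^sup>2 - (6 / Bi) * z"

definition num_B :: "real \<Rightarrow> real \<Rightarrow> real \<Rightarrow> real" where
  "num_B Ste Bi z = (3 * Ste + 6) * z\<^sup>2 + (3 / Bi) * z - 3 * Ste"

text \<open>The common denominator of the coefficients without its factor \<open>Ste\<close>, which
  is how it enters the quartic.\<close>

definition den_AB :: "real \<Rightarrow> real \<Rightarrow> real" where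
  "den_AB Bi z = z\<^sup>2 + (2 / Bi) * z + 3"

lemma coeff_eq:
  "coeff_A1 Ste Bi z = num_A Ste Bi z / (Ste * den_AB Bi z)"
  "coeff_B1 Ste Bi z = num_B Ste Bi z / (Ste * den_AB Bi z)"
  by (simp_all add: coeff_A1_def coeff_B1_def num_A_def num_B_def den_AB_def)

text \<open>The right-hand side is \<open>Ste * A^2 - 2 * B\<close> with denominators cleared. It
  splits the quartic into pieces whose signs and monotonicity are known.\<close>

lemma xi_quartic_eq:
  assumes "Bi \<noteq> 0"
  shows "2 * xi_quartic Ste Bi z = (num_A Ste Bi z)\<^sup>2 - 2 * num_B Ste Bi z * den_AB Bi z"
proof -
  \<comment> \<open>With \<open>1 / Bi\<close> as an indeterminate the claim is a polynomial
    identity.\<close>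
  define b where "b = 1 / Bi"
  have b: "x / Bi = x * b" "x / Bi\<^sup>2 = x * b\<^sup>2" for x
    by (simp_all add: b_def power_divide)
  show ?thesis
    unfolding xi_quartic_def num_A_def num_B_def den_AB_def b by algebra
qed

lemma den_AB_pos: "Bi > 0 \<Longrightarrow> z > 0 \<Longrightarrow> den_AB Bi z > 0"
  unfolding den_AB_def by (simp add: add_pos_pos)

lemma xi_min_pos:
  assumes "Ste > 0" "Bi > 0"
  shows "xi_min Ste Bi > 0"
proof -
  have "1 / Bi = sqrt (1 / Bi\<^sup>2)"
    using assms by (simp add: real_sqrt_divide)
  also have "\<dots> < sqrt (4 * Ste\<^sup>2 + 8 * Ste + 1 / Bi\<^sup>2)"
    using assms by (simp add: add_pos_pos)
  finally show ?thesis
    using assms unfolding xi_min_def by simp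
qed

text \<open>\<open>num_B\<close> is three times the quadratic whose positive root is
  \<open>xi_min\<close>.\<close>

lemma xi_min_iff:
  assumes "Ste > 0" "Bi > 0" "z > 0"
  shows "z < xi_min Ste Bi \<longleftrightarrow> num_B Ste Bi z < 0"
    and "xi_min Ste Bi < z \<longleftrightarrow> num_B Ste Bi z > 0"
proof -
  have xi: "xi_min Ste Bi = (sqrt ((1 / Bi)\<^sup>2 + 4 * (2 + Ste) * Ste) - 1 / Bi) / (2 * (2 + Ste))"
    by (simp add: xi_min_def power_divide power2_eq_square algebra_simps)
  have num: "num_B Ste Bi z = 3 * ((2 + Ste) * z\<^sup>2 + 1 / Bi * z - Ste)"
    by (simp add: num_B_def algebra_simps)
  show "z < xi_min Ste Bi \<longleftrightarrow> num_B Ste Bi z < 0"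
    unfolding xi num using assms by (subst less_positive_root_iff) auto
  show "xi_min Ste Bi < z \<longleftrightarrow> num_B Ste Bi z > 0"
    unfolding xi num using assms by (subst less_positive_root_iff) auto
qed

text \<open>\<open>num_A\<close> is \<open>- 2\<close> times the quadratic whose positive root is
  \<open>xi_max\<close>; the negative factor reverses the signs.\<close>

lemma xi_max_iff:
  assumes "Ste > 0" "Bi > 0" "z > 0"
  shows "z < xi_max Ste Bi \<longleftrightarrow> num_A Ste Bi z > 0"
    and "xi_max Ste Bi < z \<longleftrightarrow> num_A Ste Bi z < 0"
proof -
  have xi: "xi_max Ste Bi = (sqrt ((3 / Bi)\<^sup>2 + 4 * (3 + Ste) * (3 * Ste)) - 3 / Bi) / (2 * (3 + Ste))"
    by (simp add: xi_max_def power_divide power2_eq_square algebra_simps)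
  have num: "num_A Ste Bi z = - 2 * ((3 + Ste) * z\<^sup>2 + 3 / Bi * z - 3 * Ste)"
    by (simp add: num_A_def algebra_simps)
  show "z < xi_max Ste Bi \<longleftrightarrow> num_A Ste Bi z > 0"
    unfolding xi num using assms by (subst less_positive_root_iff) auto
  show "xi_max Ste Bi < z \<longleftrightarrow> num_A Ste Bi z < 0"
    unfolding xi num using assms by (subst less_positive_root_iff) auto
qed

text \<open>Trichotomy: taking \<open>z = xi_min Ste Bi\<close> in \<open>xi_min_iff\<close>
  excludes both strict signs.\<close>

lemma num_B_xi_min:
  assumes "Ste > 0" "Bi > 0"
  shows "num_B Ste Bi (xi_min Ste Bi) = 0"
  using xi_min_iff[OF assms xi_min_pos[OF assms]] by linarith

text \<open>In \<open>num_A + 2 * num_B\<close> the linear and constant terms cancel, leaving a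
  positive multiple of the square; at \<open>xi_min\<close> the second summand vanishes.\<close>

lemma xi_min_less_xi_max:
  assumes "Ste > 0" "Bi > 0"
  shows "xi_min Ste Bi < xi_max Ste Bi"
proof -
  let ?z = "xi_min Ste Bi"
  have "num_A Ste Bi ?z = (6 + 4 * Ste) * ?z\<^sup>2 - 2 * num_B Ste Bi ?z"
    by (simp add: num_A_def num_B_def algebra_simps)
  also have "\<dots> > 0"
    using assms xi_min_pos[OF assms] by (simp add: num_B_xi_min add_pos_pos)
  finally show ?thesis
    using xi_max_iff(1)[OF assms xi_min_pos[OF assms]] by simp
qed

lemma num_A_xi_max:
  assumes "Ste > 0" "Bi > 0"
  shows "num_A Ste Bi (xi_max Ste Bi) = 0"
  using xi_max_iff[OF assms order.strict_trans[OF xi_min_pos[OF assms] xi_min_less_xi_max[OF assms]]]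
  by linarith

section \<open>The root of the quartic\<close>

lemma xi_quartic_strict_antimono:
  assumes "Ste > 0" "Bi > 0" "xi_min Ste Bi \<le> y" "y < z" "z \<le> xi_max Ste Bi"
  shows "xi_quartic Ste Bi z < xi_quartic Ste Bi y"
proof -
  have y: "y > 0" using xi_min_pos assms by force
  have sq: "y\<^sup>2 < z\<^sup>2" using y assms by (simp add: power_strict_mono)
  have lin: "c / Bi * y \<le> c / Bi * z" if "c > 0" for c
    using that assms by (intro mult_left_mono) auto
  have quad: "c * y\<^sup>2 < c * z\<^sup>2" if "c > 0" for c
    using that sq by simp
  have c: "6 + 2 * Ste > 0" "3 * Ste + 6 > 0"
    using assms by auto
  have "num_A Ste Bi z < num_A Ste Bi y"
    using lin[of 6, OF zero_less_numeral] quad[OF c(1)] unfolding num_A_def by linarith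
  \<comment> \<open>Nonnegativity up to the right endpoint lets the decrease of \<open>num_A\<close>
    pass to its square; this square supplies the strictness.\<close>
  moreover have "num_A Ste Bi z \<ge> 0"
    using xi_max_iff(2)[of Ste Bi z] assms y by linarith
  ultimately have A: "(num_A Ste Bi z)\<^sup>2 < (num_A Ste Bi y)\<^sup>2"
    by (simp add: power_strict_mono)
  have "num_B Ste Bi y \<le> num_B Ste Bi z"
    using lin[of 3, OF zero_less_numeral] quad[OF c(2)] unfolding num_B_def by linarith
  moreover have "num_B Ste Bi y \<ge> 0"
    using xi_min_iff(1)[of Ste Bi y] assms y by linarith
  moreover have "den_AB Bi y \<le> den_AB Bi z"
    using lin[of 2] sq unfolding den_AB_def by simp
  ultimately have "num_B Ste Bi y * den_AB Bi y \<le> num_B Ste Bi z * den_AB Bi z"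
    using den_AB_pos[of Bi y] assms y by (intro mult_mono) auto
  with A show ?thesis
    using xi_quartic_eq[of Bi Ste y] xi_quartic_eq[of Bi Ste z] assms by simp
qed

lemma ex1_xi_quartic_root:
  assumes S: "Ste > 0" and B: "Bi > 0"
  shows "\<exists>!z. xi_min Ste Bi < z \<and> z < xi_max Ste Bi \<and> xi_quartic Ste Bi z = 0"
proof -
  let ?a = "xi_min Ste Bi" and ?b = "xi_max Ste Bi"
  note ab = xi_min_less_xi_max[OF S B] and a0 = xi_min_pos[OF S B]
  then have b0: "?b > 0" by linarith
  have "num_A Ste Bi ?a > 0" "num_B Ste Bi ?b > 0"
    using xi_max_iff(1)[OF S B a0] xi_min_iff(2)[OF S B b0] ab by auto
  \<comment> \<open>Twice the quartic is the square of \<open>num_A\<close> at the left endpoint and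
    \<open>- 2 * num_B * den_AB\<close> at the right one.\<close>
  then have sgn: "xi_quartic Ste Bi ?a > 0" "xi_quartic Ste Bi ?b < 0"
    using xi_quartic_eq[of Bi Ste ?a] xi_quartic_eq[of Bi Ste ?b] den_AB_pos[OF B b0] B
    by (auto simp: num_B_xi_min[OF S B] num_A_xi_max[OF S B] zero_less_mult_iff)
      (smt (verit) mult_pos_pos zero_less_power)+
  have "continuous_on {?a..?b} (xi_quartic Ste Bi)"
    unfolding xi_quartic_def by (intro continuous_intros)
  then obtain z where z: "?a \<le> z" "z \<le> ?b" "xi_quartic Ste Bi z = 0"
    using IVT2'[of "xi_quartic Ste Bi" ?b 0 ?a] sgn ab by auto
  then have "?a < z \<and> z < ?b \<and> xi_quartic Ste Bi z = 0"
    using sgn by (metis less_irrefl order_le_less)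
  moreover have "y = z" if "?a < y \<and> y < ?b \<and> xi_quartic Ste Bi y = 0" for y
    using that z xi_quartic_strict_antimono[OF S B, of y z] xi_quartic_strict_antimono[OF S B, of z y]
    by (metis less_irrefl less_imp_le linorder_neqE)
  ultimately show ?thesis by blast
qed

section \<open>The algebraic system for \<open>A\<close>, \<open>B\<close> and
  \<open>z\<close>\<close>

text \<open>The three equations express the heat balance, the convective condition and the curvature
  condition. For fixed \<open>z\<close> the first two are a regular linear system in
  \<open>A\<close> and \<open>B\<close>; given its solution, the curvature condition is the quartic
  and positivity is the pair of bounds.\<close>

lemma algebraic_system_iff:
  fixes A B z :: real
  assumes S: "Ste > 0" and Bi: "Bi > 0" and z: "z > 0"
  shows "A > 0 \<and> B > 0 \<and> 2 * z\<^sup>2 * (1 + Ste * (A / 2 + B / 3)) = Ste * (A + 2 * B) \<and>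
      2 * Bi * z * (1 - A - B) = A + 2 * B \<and> Ste * A\<^sup>2 = 2 * B \<longleftrightarrow>
    xi_min Ste Bi < z \<and> z < xi_max Ste Bi \<and> xi_quartic Ste Bi z = 0 \<and>
      A = coeff_A1 Ste Bi z \<and> B = coeff_B1 Ste Bi z"
proof -
  define b where "b = 1 / Bi"
  have b: "x / Bi = x * b" "b * Bi = 1" for x
    using Bi by (simp_all add: b_def)
  define D where "D = Ste * den_AB Bi z"
  have D: "D > 0" using den_AB_pos[OF Bi z] S by (simp add: D_def)
  have De: "D = Ste * (z\<^sup>2 + 2 * b * z + 3)" by (simp add: D_def den_AB_def b)
  have nA: "num_A Ste Bi z = 6 * Ste - (6 + 2 * Ste) * z\<^sup>2 - 6 * b * z" by (simp add: num_A_def b)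
  have nB: "num_B Ste Bi z = (3 * Ste + 6) * z\<^sup>2 + 3 * b * z - 3 * Ste" by (simp add: num_B_def b)
  have A1: "A = coeff_A1 Ste Bi z \<longleftrightarrow> A * D = num_A Ste Bi z"
    and B1: "B = coeff_B1 Ste Bi z \<longleftrightarrow> B * D = num_B Ste Bi z"
    using D by (simp_all add: coeff_eq D_def[symmetric] nonzero_eq_divide_eq)
  have lin: "2 * z\<^sup>2 * (1 + Ste * (A / 2 + B / 3)) = Ste * (A + 2 * B) \<and>
      2 * Bi * z * (1 - A - B) = A + 2 * B \<longleftrightarrow> A = coeff_A1 Ste Bi z \<and> B = coeff_B1 Ste Bi z"
    (is "?E1 \<and> ?E2 \<longleftrightarrow> _")
  proof -
    have E1: "?E1 \<longleftrightarrow> 6 * z\<^sup>2 = Ste * (3 * A + 6 * B) - z\<^sup>2 * Ste * (3 * A + 2 * B)"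
      by (auto simp: field_simps)
    have E2: "?E2 \<longleftrightarrow> 2 * z * (1 - A - B) = b * (A + 2 * B)"
      using Bi by (auto simp: b_def field_simps)
    show ?thesis
    proof
      assume *: "?E1 \<and> ?E2"
      then have "6 * z\<^sup>2 = Ste * (3 * A + 6 * B) - z\<^sup>2 * Ste * (3 * A + 2 * B)"
        "2 * z * (1 - A - B) = b * (A + 2 * B)" using E1 E2 by auto
      \<comment> \<open>Cramer's rule: the determinant of the linear system is
        \<open>- 2 * z * D\<close>, hence the extra factor \<open>z\<close>.\<close>
      then have "z * (A * D) = z * num_A Ste Bi z" "z * (B * D) = z * num_B Ste Bi z"
        unfolding De nA nB by algebra+
      then show "A = coeff_A1 Ste Bi z \<and> B = coeff_B1 Ste Bi z"
        unfolding A1 B1 using z by simp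
    next
      assume "A = coeff_A1 Ste Bi z \<and> B = coeff_B1 Ste Bi z"
      then have AB: "A * D = num_A Ste Bi z" "B * D = num_B Ste Bi z" using A1 B1 by auto
      \<comment> \<open>Multiplying by \<open>D\<close> keeps the verification polynomial;
        \<open>D > 0\<close> is cancelled afterwards.\<close>
      have "D * (6 * z\<^sup>2) = D * (Ste * (3 * A + 6 * B) - z\<^sup>2 * Ste * (3 * A + 2 * B))"
        using AB unfolding De nA nB by algebra
      moreover have "D * (2 * z * (1 - A - B)) = D * (b * (A + 2 * B))"
        using AB unfolding De nA nB by algebra
      ultimately show "?E1 \<and> ?E2" unfolding E1 E2 using D by simp
    qed
  qed
  have "A > 0 \<and> B > 0 \<and> Ste * A\<^sup>2 = 2 * B \<longleftrightarrow>
      xi_min Ste Bi < z \<and> z < xi_max Ste Bi \<and> xi_quartic Ste Bi z = 0"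
    if "A = coeff_A1 Ste Bi z" "B = coeff_B1 Ste Bi z"
  proof -
    have AB: "num_A Ste Bi z = A * D" "num_B Ste Bi z = B * D" using that A1 B1 by auto
    have "Ste * (2 * xi_quartic Ste Bi z) = D\<^sup>2 * (Ste * A\<^sup>2 - 2 * B)"
      using Bi unfolding xi_quartic_eq[OF less_imp_neq[OF Bi, symmetric]] AB
      unfolding D_def by algebra
    then have "xi_quartic Ste Bi z = 0 \<longleftrightarrow> Ste * A\<^sup>2 = 2 * B"
      using S D by auto
    moreover have "z < xi_max Ste Bi \<longleftrightarrow> A > 0" "xi_min Ste Bi < z \<longleftrightarrow> B > 0"
      using xi_max_iff(1)[OF S Bi z] xi_min_iff(2)[OF S Bi z] D
      by (simp_all add: AB zero_less_mult_iff)
    ultimately show ?thesis by blast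
  qed
  with lin show ?thesis by blast
qed

section \<open>Calculus of the quadratic profile\<close>

text \<open>This identifies the existentially quantified \<open>Tx\<close> and \<open>Txx\<close> of
  \<open>P1_solution\<close> with the explicit derivatives, also at the endpoints, where they are
  one-sided.\<close>

lemma has_real_derivative_unique_Icc:
  fixes f :: "real \<Rightarrow> real"
  assumes "a < b" "x \<in> {a..b}"
    and "(f has_real_derivative D) (at x within {a..b})"
    and "(f has_real_derivative E) (at x within {a..b})"
  shows "D = E"
  using vector_derivative_unique_within_closed_interval[of a b x f D E] assms
  by (simp add: has_real_derivative_iff_has_vector_derivative)

lemma quadratic_profile_has_derivative:
  "((\<lambda>y. quadratic_profile A B \<Theta> s y t) has_real_derivative
    \<Theta> / s t * (A + 2 * B * (1 - x / s t))) (at x within S)"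
proof -
  define c where "c = inverse (s t)"
  have c: "y / s t = y * c" for y by (simp add: c_def divide_inverse)
  show ?thesis
    unfolding quadratic_profile_def c
    by (auto intro!: derivative_eq_intros simp: algebra_simps)
qed

lemma quadratic_profile_integral:
  assumes "s t > 0"
  shows "integral {0..s t} (\<lambda>x. quadratic_profile A B \<Theta> s x t) = - \<Theta> * (A / 2 + B / 3) * s t"
proof (rule integral_unique)
  \<comment> \<open>Antiderivative in the variable \<open>1 - x / s t\<close>, whose derivative
    \<open>- 1 / s t\<close> cancels the factor \<open>s t\<close>. It vanishes at
    \<open>x = s t\<close>.\<close>
  define F where
    "F x = \<Theta> * s t * (A / 2 * (1 - x / s t)\<^sup>2 + B / 3 * (1 - x / s t) ^ 3)" for x
  define c where "c = inverse (s t)"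
  have c: "y / s t = y * c" "s t * c = 1" for y
    using assms by (simp_all add: c_def divide_inverse)
  have "(F has_real_derivative - \<Theta> * (s t * c) * (A * (1 - x * c) + B * (1 - x * c)\<^sup>2))
      (at x within {0..s t})" for x
    unfolding F_def[abs_def] c(1)
    by (auto intro!: derivative_eq_intros simp: field_simps power2_eq_square)
  moreover have "quadratic_profile A B \<Theta> s x t =
      - \<Theta> * (s t * c) * (A * (1 - x * c) + B * (1 - x * c)\<^sup>2)" for x
    unfolding quadratic_profile_def c by (simp add: algebra_simps)
  ultimately have "((\<lambda>x. quadratic_profile A B \<Theta> s x t) has_integral F (s t) - F 0) {0..s t}"
    using assms by (intro fundamental_theorem_of_calculus)
      (auto simp: has_real_derivative_iff_has_vector_derivative)
  moreover have "F (s t) - F 0 = - \<Theta> * (A / 2 + B / 3) * s t"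
    using assms by (simp add: F_def algebra_simps)
  ultimately show "((\<lambda>x. quadratic_profile A B \<Theta> s x t) has_integral
      - \<Theta> * (A / 2 + B / 3) * s t) {0..s t}" by simp
qed

section \<open>Reduction of (P1) for a quadratic profile\<close>

text \<open>Profile, derivatives and integral are explicit, so each condition becomes a relation
  between \<open>s\<close>, \<open>A\<close> and \<open>B\<close>; the condition at the front holds
  by the form of the profile.\<close>

lemma P1_solution_quadratic_iff:
  assumes s_pos: "\<forall>t>0. s t > 0" and s_diff: "\<forall>t>0. s differentiable at t"
    and T_eq: "\<forall>t>0. \<forall>x\<in>{0..s t}. T x t = quadratic_profile A B \<Theta> s x t"
  shows "P1_solution k \<rho> c lam \<Theta> h T s \<longleftrightarrow> s 0 = 0 \<and>
    (\<forall>t>0. - \<Theta> * (A / 2 + B / 3) * deriv s t =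
      k / (\<rho> * c) * (\<rho> * lam / k * deriv s t - \<Theta> / s t * (A + 2 * B))) \<and>
    (\<forall>t>0. k * (\<Theta> / s t * (A + 2 * B)) = h / sqrt t * (\<Theta> * (1 - A - B))) \<and>
    (A * \<Theta>)\<^sup>2 = lam / c * (2 * B * \<Theta>)"
proof -
  note s = s_pos[rule_format] and ds = s_diff[rule_format] and T = T_eq[rule_format]
  define gx where "gx x t = \<Theta> / s t * (A + 2 * B * (1 - x / s t))" for x t
  define gxx where "gxx x t = - 2 * B * \<Theta> / (s t)\<^sup>2" for x t :: real
  have dT: "((\<lambda>y. T y t) has_real_derivative gx x t) (at x within {0..s t})"
    if "t > 0" "x \<in> {0..s t}" for t x
    using quadratic_profile_has_derivative zero_less_one that(2)
    unfolding gx_def by (rule has_field_derivative_transform_within) (simp add: T that)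
  have dgx: "((\<lambda>y. gx y t) has_real_derivative gxx x t) (at x within {0..s t})"
    if "t > 0" for t x
    unfolding gx_def gxx_def using s[OF that]
    by (auto intro!: derivative_eq_intros simp: field_simps power2_eq_square)
  have int: "integral {0..s t} (\<lambda>x. T x t) = - \<Theta> * (A / 2 + B / 3) * s t" if "t > 0" for t
    using quadratic_profile_integral[of s t A B \<Theta>] s[OF that] T[OF that]
    by (metis (mono_tags, lifting) integral_cong)
  have dint: "((\<lambda>\<tau>. integral {0..s \<tau>} (\<lambda>x. T x \<tau>)) has_real_derivative
      - \<Theta> * (A / 2 + B / 3) * deriv s t) (at t)" if "t > 0" for t
  proof -
    have "(s has_real_derivative deriv s t) (at t)"
      using ds[OF that] by (simp add: DERIV_deriv_iff_real_differentiable)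
    then have "((\<lambda>\<tau>. - \<Theta> * (A / 2 + B / 3) * s \<tau>) has_real_derivative
        - \<Theta> * (A / 2 + B / 3) * deriv s t) (at t)"
      by (rule DERIV_cmult)
    then show ?thesis
      \<comment> \<open>The integral formula holds only at positive times, which form an open
        neighbourhood of \<open>t\<close>.\<close>
      by (rule has_field_derivative_transform_within_open[where S = "{0<..}"]) (use that int in auto)
  qed
  have gx0: "gx 0 t = \<Theta> / s t * (A + 2 * B)" for t by (simp add: gx_def)
  have gxs: "gx (s t) t = \<Theta> / s t * A" if "t > 0" for t
    using s[OF that] by (simp add: gx_def)
  have T0: "T 0 t = - A * \<Theta> - B * \<Theta>" and Ts: "T (s t) t = 0" if "t > 0" for t
    using T[OF that] s[OF that] by (auto simp: quadratic_profile_def)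
  \<comment> \<open>Both sides carry the factor \<open>1 / (s t)^2\<close>, so the condition does
    not depend on time.\<close>
  have curv: "(gx (s t) t)\<^sup>2 = - (lam / c) * gxx (s t) t \<longleftrightarrow> (A * \<Theta>)\<^sup>2 = lam / c * (2 * B * \<Theta>)"
    if "t > 0" for t
  proof -
    have "(gx (s t) t)\<^sup>2 = (A * \<Theta>)\<^sup>2 / (s t)\<^sup>2"
      "- (lam / c) * gxx (s t) t = lam / c * (2 * B * \<Theta>) / (s t)\<^sup>2"
      unfolding gxs[OF that] gxx_def by (simp_all add: power_divide power_mult_distrib mult_ac)
    then show ?thesis using s[OF that] by (simp only: divide_cancel_right) simp
  qed
  show ?thesis
  proof
    assume "P1_solution k \<rho> c lam \<Theta> h T s"
    then obtain Tx Txx where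
      derivs: "\<forall>t>0. \<forall>x\<in>{0..s t}.
        ((\<lambda>y. T y t) has_real_derivative Tx x t) (at x within {0..s t}) \<and>
        ((\<lambda>y. Tx y t) has_real_derivative Txx x t) (at x within {0..s t})" and
      heat: "\<forall>t>0. s differentiable at t \<and>
        ((\<lambda>\<tau>. integral {0..s \<tau>} (\<lambda>x. T x \<tau>)) has_real_derivative
          (k / (\<rho> * c)) * ((\<rho> * lam / k) * deriv s t - Tx 0 t)) (at t)" and
      conv: "\<forall>t>0. k * Tx 0 t = (h / sqrt t) * (T 0 t + \<Theta>)" and
      stefan: "\<forall>t>0. (Tx (s t) t)\<^sup>2 = - (lam / c) * Txx (s t) t" and
      s0: "s 0 = 0"
      unfolding P1_solution_def by (elim exE conjE)
    have Tx: "((\<lambda>y. T y t) has_real_derivative Tx x t) (at x within {0..s t})"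
      and Txx: "((\<lambda>y. Tx y t) has_real_derivative Txx x t) (at x within {0..s t})"
      if "t > 0" "x \<in> {0..s t}" for t x
      using derivs that by simp_all
    have Tx_eq: "Tx x t = gx x t" if "t > 0" "x \<in> {0..s t}" for t x
      using has_real_derivative_unique_Icc[OF s[OF that(1)] that(2) Tx[OF that] dT[OF that]] .
    have Txx_eq: "Txx x t = gxx x t" if "t > 0" "x \<in> {0..s t}" for t x
    proof -
      \<comment> \<open>\<open>Tx\<close> and \<open>gx\<close> agree on \<open>{0..s t}\<close>
        only, which is enough for a derivative within that set.\<close>
      have "((\<lambda>y. gx y t) has_real_derivative Txx x t) (at x within {0..s t})"
        using Txx[OF that] zero_less_one that(2)
        by (rule has_field_derivative_transform_within) (simp add: Tx_eq that)
      then show ?thesis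
        using has_real_derivative_unique_Icc[OF s[OF that(1)] that(2) _ dgx[OF that(1)]] by blast
    qed
    have ends: "Tx 0 t = gx 0 t" "Tx (s t) t = gx (s t) t" "Txx (s t) t = gxx (s t) t" if "t > 0" for t
      using Tx_eq Txx_eq s[OF that] that by auto
    show "s 0 = 0 \<and>
      (\<forall>t>0. - \<Theta> * (A / 2 + B / 3) * deriv s t =
        k / (\<rho> * c) * (\<rho> * lam / k * deriv s t - \<Theta> / s t * (A + 2 * B))) \<and>
      (\<forall>t>0. k * (\<Theta> / s t * (A + 2 * B)) = h / sqrt t * (\<Theta> * (1 - A - B))) \<and>
      (A * \<Theta>)\<^sup>2 = lam / c * (2 * B * \<Theta>)"
    proof (intro conjI allI impI)
      fix t :: real assume t: "t > 0"
      show "- \<Theta> * (A / 2 + B / 3) * deriv s t =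
          k / (\<rho> * c) * (\<rho> * lam / k * deriv s t - \<Theta> / s t * (A + 2 * B))"
        using DERIV_unique[OF dint[OF t] heat[rule_format, OF t, THEN conjunct2]] unfolding ends(1)[OF t] gx0 .
      show "k * (\<Theta> / s t * (A + 2 * B)) = h / sqrt t * (\<Theta> * (1 - A - B))"
        using conv[rule_format, OF t] by (simp add: ends t gx0 T0 algebra_simps)
    next
      show "(A * \<Theta>)\<^sup>2 = lam / c * (2 * B * \<Theta>)"
        \<comment> \<open>The condition being independent of time, the instant \<open>1\<close>
          serves.\<close>
        using stefan[rule_format, of 1] curv[of 1] by (simp add: ends)
    qed (rule s0)
  next
    assume *: "s 0 = 0 \<and>
      (\<forall>t>0. - \<Theta> * (A / 2 + B / 3) * deriv s t =
        k / (\<rho> * c) * (\<rho> * lam / k * deriv s t - \<Theta> / s t * (A + 2 * B))) \<and>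
      (\<forall>t>0. k * (\<Theta> / s t * (A + 2 * B)) = h / sqrt t * (\<Theta> * (1 - A - B))) \<and>
      (A * \<Theta>)\<^sup>2 = lam / c * (2 * B * \<Theta>)"
    show "P1_solution k \<rho> c lam \<Theta> h T s"
      unfolding P1_solution_def
    proof (rule exI[of _ gx], rule exI[of _ gxx], intro conjI allI impI ballI)
      fix t :: real assume t: "t > 0"
      show "((\<lambda>\<tau>. integral {0..s \<tau>} (\<lambda>x. T x \<tau>)) has_real_derivative
          (k / (\<rho> * c)) * ((\<rho> * lam / k) * deriv s t - gx 0 t)) (at t)"
        using dint[OF t] * t by (simp add: gx0)
      show "k * gx 0 t = (h / sqrt t) * (T 0 t + \<Theta>)"
      proof -
        have "T 0 t + \<Theta> = \<Theta> * (1 - A - B)" using T0[OF t] by (simp add: algebra_simps)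
        then show ?thesis using * t by (simp add: gx0)
      qed
      show "(gx (s t) t)\<^sup>2 = - (lam / c) * gxx (s t) t"
        using curv[OF t] * by simp
    qed (use dT dgx Ts ds * in auto)
  qed
qed

section \<open>Fronts proportional to the square root of time\<close>

lemma stefan_front_derivative:
  assumes "\<alpha> > 0" "t > 0"
  shows "((\<lambda>t. 2 * z * sqrt (\<alpha> * t)) has_real_derivative z * \<alpha> / sqrt (\<alpha> * t)) (at t)"
  using mult_pos_pos[OF assms] by (auto intro!: derivative_eq_intros simp: field_simps)

text \<open>For this front \<open>s t * deriv s t\<close> and \<open>s t / sqrt t\<close> are
  constant in time, so \<open>t\<close> cancels from every condition.\<close>

lemma P1_solution_sqrt_front_iff:
  assumes pos: "k > 0" "\<rho> > 0" "c > 0" "lam > 0" "\<Theta> > 0" "h > 0"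
    and \<alpha>: "\<alpha> = k / (\<rho> * c)" and Ste: "Ste = c * \<Theta> / lam" and Bi: "Bi = h * sqrt \<alpha> / k"
    and z: "z > 0" and s_eq: "\<forall>t\<ge>0. s t = 2 * z * sqrt (\<alpha> * t)"
    and T: "\<forall>t>0. \<forall>x\<in>{0..s t}. T x t = quadratic_profile A B \<Theta> s x t"
  shows "P1_solution k \<rho> c lam \<Theta> h T s \<longleftrightarrow>
    2 * z\<^sup>2 * (1 + Ste * (A / 2 + B / 3)) = Ste * (A + 2 * B) \<and>
    2 * Bi * z * (1 - A - B) = A + 2 * B \<and> Ste * A\<^sup>2 = 2 * B"
proof -
  note s = s_eq[rule_format]
  have \<alpha>0: "\<alpha> > 0" using pos by (simp add: \<alpha>)
  have sp: "\<forall>t>0. s t > 0" using z \<alpha>0 by (simp add: s)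
  have ds: "(s has_real_derivative z * \<alpha> / sqrt (\<alpha> * t)) (at t)" if "t > 0" for t
    using stefan_front_derivative[OF \<alpha>0 that]
    by (rule has_field_derivative_transform_within_open[where S = "{0<..}"]) (use that s in auto)
  have heat: "- \<Theta> * (A / 2 + B / 3) * deriv s t =
        k / (\<rho> * c) * (\<rho> * lam / k * deriv s t - \<Theta> / s t * (A + 2 * B)) \<longleftrightarrow>
      2 * z\<^sup>2 * (1 + Ste * (A / 2 + B / 3)) = Ste * (A + 2 * B)" if t: "t > 0" for t
  proof -
    define r where "r = sqrt (\<alpha> * t)"
    have r: "r > 0" using t \<alpha>0 by (simp add: r_def)
    \<comment> \<open>This is \<open>lam * \<alpha> / (c * s t)\<close>, the nonzero factor relating
      the defect of the heat balance to that of the algebraic equation.\<close>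
    define m where "m = lam * \<alpha> / (2 * c * z * r)"
    have m: "m \<noteq> 0" using pos \<alpha>0 z r by (simp add: m_def)
    have L: "k / (\<rho> * c) * (\<rho> * lam / k * X - Y) = lam / c * X - \<alpha> * Y" for X Y
      using pos by (simp add: \<alpha> field_simps)
    have \<Theta>: "\<Theta> = Ste * lam / c" using pos by (simp add: Ste)
    have "- \<Theta> * (A / 2 + B / 3) * deriv s t -
        k / (\<rho> * c) * (\<rho> * lam / k * deriv s t - \<Theta> / s t * (A + 2 * B)) =
        m * (Ste * (A + 2 * B) - 2 * z\<^sup>2 * (1 + Ste * (A / 2 + B / 3)))"
      unfolding L DERIV_imp_deriv[OF ds[OF t]] s[OF less_imp_le[OF t]] r_def[symmetric] m_def \<Theta>
      using pos z r by (simp add: field_simps power2_eq_square)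
    then show ?thesis using m by (metis eq_iff_diff_eq_0 mult_eq_0_iff)
  qed
  have conv: "k * (\<Theta> / s t * (A + 2 * B)) = h / sqrt t * (\<Theta> * (1 - A - B)) \<longleftrightarrow>
      2 * Bi * z * (1 - A - B) = A + 2 * B" if t: "t > 0" for t
  proof -
    \<comment> \<open>This is \<open>k * \<Theta> / s t\<close> with the square root split, the
      factor common to both sides.\<close>
    define m where "m = k * \<Theta> / (2 * z * sqrt \<alpha> * sqrt t)"
    have m: "m \<noteq> 0" using pos z t \<alpha>0 by (simp add: m_def)
    have "k * (\<Theta> / s t * (A + 2 * B)) = m * (A + 2 * B)"
      "h / sqrt t * (\<Theta> * (1 - A - B)) = m * (2 * Bi * z * (1 - A - B))"
      unfolding s[OF less_imp_le[OF t]] Bi real_sqrt_mult m_def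
      using pos z t \<alpha>0 by simp_all
    then show ?thesis using m by auto
  qed
  have curv: "(A * \<Theta>)\<^sup>2 = lam / c * (2 * B * \<Theta>) \<longleftrightarrow> Ste * A\<^sup>2 = 2 * B"
    using pos by (auto simp: Ste field_simps power2_eq_square)
  have dif: "\<forall>t>0. s differentiable at t"
    using ds by (auto simp: real_differentiable_def)
  have s0: "s 0 = 0" using s by simp
  show ?thesis
    unfolding P1_solution_quadratic_iff[OF sp dif T] curv
    using s0 heat conv zero_less_one by blast
qed

section \<open>Existence and uniqueness of the quadratic solution\<close>

lemma P1_quadratic_solution_exists:
  assumes pos: "k > 0" "\<rho> > 0" "c > 0" "lam > 0" "\<Theta> > 0" "h > 0"
    and \<alpha>: "\<alpha> = k / (\<rho> * c)" and Ste: "Ste = c * \<Theta> / lam" and Bi: "Bi = h * sqrt \<alpha> / k"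
    and z: "z > 0" and AB: "A > 0" "B > 0"
    and sys: "2 * z\<^sup>2 * (1 + Ste * (A / 2 + B / 3)) = Ste * (A + 2 * B)"
      "2 * Bi * z * (1 - A - B) = A + 2 * B" "Ste * A\<^sup>2 = 2 * B"
  defines "s \<equiv> \<lambda>t. 2 * z * sqrt (\<alpha> * t)"
  shows "P1_quadratic_solution k \<rho> c lam \<Theta> h (quadratic_profile A B \<Theta> s) s"
  unfolding P1_quadratic_solution_def
proof (intro conjI allI impI)
  have \<alpha>0: "\<alpha> > 0" using pos by (simp add: \<alpha>)
  show "P1_solution k \<rho> c lam \<Theta> h (quadratic_profile A B \<Theta> s) s"
    by (subst P1_solution_sqrt_front_iff[OF pos \<alpha> Ste Bi z]) (use sys in \<open>simp_all add: s_def\<close>)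
  show "\<exists>A'>0. \<exists>B'>0. \<forall>t>0. \<forall>x\<in>{0..s t}.
      quadratic_profile A B \<Theta> s x t = quadratic_profile A' B' \<Theta> s x t"
    using AB by blast
  show "continuous_on {0..} s"
    unfolding s_def by (intro continuous_intros)
  have ds: "(s has_real_derivative z * \<alpha> / sqrt (\<alpha> * t)) (at t)" if "t > 0" for t
    unfolding s_def by (rule stefan_front_derivative[OF \<alpha>0 that])
  then show "s differentiable at t" if "t > 0" for t
    using that by (auto simp: real_differentiable_def)
  have "continuous_on {0<..} (\<lambda>t. z * \<alpha> / sqrt (\<alpha> * t))"
    using \<alpha>0 by (intro continuous_intros) auto
  then show "continuous_on {0<..} (deriv s)"
    by (rule continuous_on_eq) (auto simp: DERIV_imp_deriv[OF ds])
  show "s t > 0" if "t > 0" for t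
    using that \<alpha>0 z by (simp add: s_def)
qed

text \<open>The convective condition alone ties \<open>s t\<close> to \<open>sqrt t\<close>, so no
  differential equation is solved: the front is known first, and the remaining conditions then
  constrain the constants.\<close>

lemma P1_quadratic_solutionE:
  assumes pos: "k > 0" "\<rho> > 0" "c > 0" "lam > 0" "\<Theta> > 0" "h > 0"
    and \<alpha>: "\<alpha> = k / (\<rho> * c)" and Ste: "Ste = c * \<Theta> / lam" and Bi: "Bi = h * sqrt \<alpha> / k"
    and sol: "P1_quadratic_solution k \<rho> c lam \<Theta> h T s"
  obtains A B z where "A > 0" "B > 0" "z > 0"
    "\<forall>t\<ge>0. s t = 2 * z * sqrt (\<alpha> * t)"
    "\<forall>t>0. \<forall>x\<in>{0..s t}. T x t = quadratic_profile A B \<Theta> s x t"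
    "2 * z\<^sup>2 * (1 + Ste * (A / 2 + B / 3)) = Ste * (A + 2 * B)"
    "2 * Bi * z * (1 - A - B) = A + 2 * B" "Ste * A\<^sup>2 = 2 * B"
proof -
  have \<alpha>0: "\<alpha> > 0" using pos by (simp add: \<alpha>)
  have P1: "P1_solution k \<rho> c lam \<Theta> h T s"
    and sp: "\<forall>t>0. s t > 0" and ds: "\<forall>t>0. s differentiable at t"
    using sol unfolding P1_quadratic_solution_def by simp_all
  obtain A B where AB: "A > 0" "B > 0" and
    T: "\<forall>t>0. \<forall>x\<in>{0..s t}. T x t = quadratic_profile A B \<Theta> s x t"
    using sol unfolding P1_quadratic_solution_def by blast
  have s0: "s 0 = 0" and
    conv: "\<forall>t>0. k * (\<Theta> / s t * (A + 2 * B)) = h / sqrt t * (\<Theta> * (1 - A - B))"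
    using P1 unfolding P1_solution_quadratic_iff[OF sp ds T] by blast+
  \<comment> \<open>A positive flux at time \<open>1\<close> forces \<open>A + B < 1\<close>, so the
    convective condition can be solved for the front.\<close>
  have "k * (\<Theta> / s 1 * (A + 2 * B)) > 0"
    using pos AB sp by simp
  then have AB1: "1 - A - B > 0"
    using conv pos by (auto simp: zero_less_mult_iff dest: spec[of _ 1])
  \<comment> \<open>The value of \<open>s t / (2 * sqrt (\<alpha> * t))\<close> dictated by the
    convective condition.\<close>
  define z where "z = k * (A + 2 * B) / (2 * h * sqrt \<alpha> * (1 - A - B))"
  have z: "z > 0"
    unfolding z_def using pos AB AB1 \<alpha>0 by simp
  have s_eq: "s t = 2 * z * sqrt (\<alpha> * t)" if "t \<ge> 0" for t
  proof (cases "t = 0")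
    case False
    with that have t: "t > 0" by simp
    have "\<Theta> * (k * (A + 2 * B) * sqrt t) = \<Theta> * (s t * (h * (1 - A - B)))"
      using conv[rule_format, OF t] sp[rule_format, OF t] pos t by (simp add: field_simps)
    then have "k * (A + 2 * B) * sqrt t = s t * (h * (1 - A - B))"
      using pos by simp
    moreover have "2 * z * sqrt (\<alpha> * t) * (h * (1 - A - B)) = k * (A + 2 * B) * sqrt t"
      unfolding z_def real_sqrt_mult using pos AB1 \<alpha>0 by (simp add: divide_simps)
    ultimately have "2 * z * sqrt (\<alpha> * t) * (h * (1 - A - B)) = s t * (h * (1 - A - B))"
      by simp
    then show ?thesis using pos AB1 by simp
  qed (simp add: s0)
  then have s: "\<forall>t\<ge>0. s t = 2 * z * sqrt (\<alpha> * t)" by blast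
  show thesis
    using P1_solution_sqrt_front_iff[OF pos \<alpha> Ste Bi z s T] P1 by (intro that[OF AB z s T]) simp_all
qed

theorem theorem3p1:
  fixes k \<rho> c lam \<Theta> h \<alpha> Ste Bi :: real
  assumes "k > 0" and "\<rho> > 0" and "c > 0" and "lam > 0" and "\<Theta> > 0" and "h > 0"
    and "\<alpha> = k / (\<rho> * c)" and "Ste = c * \<Theta> / lam" and "Bi = h * sqrt \<alpha> / k"
  shows "(\<exists>!z. xi_min Ste Bi < z \<and> z < xi_max Ste Bi \<and> xi_quartic Ste Bi z = 0) \<and>
    (\<forall>\<xi>\<^sub>1. xi_min Ste Bi < \<xi>\<^sub>1 \<and> \<xi>\<^sub>1 < xi_max Ste Bi \<and> xi_quartic Ste Bi \<xi>\<^sub>1 = 0 \<longrightarrow>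
      (let A\<^sub>1 = coeff_A1 Ste Bi \<xi>\<^sub>1;
           B\<^sub>1 = coeff_B1 Ste Bi \<xi>\<^sub>1;
           s\<^sub>1 = (\<lambda>t. 2 * \<xi>\<^sub>1 * sqrt (\<alpha> * t));
           T\<^sub>1 = quadratic_profile A\<^sub>1 B\<^sub>1 \<Theta> s\<^sub>1
       in A\<^sub>1 > 0 \<and> B\<^sub>1 > 0 \<and>
          P1_quadratic_solution k \<rho> c lam \<Theta> h T\<^sub>1 s\<^sub>1 \<and>
          (\<forall>T s. P1_quadratic_solution k \<rho> c lam \<Theta> h T s \<longrightarrow>
             (\<forall>t\<ge>0. s t = s\<^sub>1 t) \<and>
             (\<forall>t>0. \<forall>x\<in>{0..s\<^sub>1 t}. T x t = T\<^sub>1 x t))))"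
proof -
  have \<alpha>: "\<alpha> > 0" and S: "Ste > 0" and Bi: "Bi > 0"
    using assms by simp_all
  note ex1 = ex1_xi_quartic_root[OF S Bi]
  show ?thesis
    unfolding Let_def
  proof (rule conjI[OF ex1], intro allI impI)
    fix z assume z: "xi_min Ste Bi < z \<and> z < xi_max Ste Bi \<and> xi_quartic Ste Bi z = 0"
    then have z0: "z > 0" using xi_min_pos[OF S Bi] by linarith
    let ?A = "coeff_A1 Ste Bi z" and ?B = "coeff_B1 Ste Bi z"
    let ?s = "\<lambda>t. 2 * z * sqrt (\<alpha> * t)"
    have sys: "?A > 0" "?B > 0"
      "2 * z\<^sup>2 * (1 + Ste * (?A / 2 + ?B / 3)) = Ste * (?A + 2 * ?B)"
      "2 * Bi * z * (1 - ?A - ?B) = ?A + 2 * ?B" "Ste * ?A\<^sup>2 = 2 * ?B"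
      using algebraic_system_iff[OF S Bi z0, of ?A ?B] z by blast+
    \<comment> \<open>A competing solution has its own parameter \<open>z'\<close>; the algebraic
      system makes it a root of the quartic between the bounds, hence equal to \<open>z\<close>, and
      then the coefficients agree as well.\<close>
    have unique: "(\<forall>t\<ge>0. s t = ?s t) \<and>
        (\<forall>t>0. \<forall>x\<in>{0..?s t}. T x t = quadratic_profile ?A ?B \<Theta> ?s x t)"
      if sol: "P1_quadratic_solution k \<rho> c lam \<Theta> h T s" for T s
    proof -
      obtain A B z' where AB: "A > 0" "B > 0" and z': "z' > 0" and
        s: "\<forall>t\<ge>0. s t = 2 * z' * sqrt (\<alpha> * t)" and
        T: "\<forall>t>0. \<forall>x\<in>{0..s t}. T x t = quadratic_profile A B \<Theta> s x t" and
        sys': "2 * z'\<^sup>2 * (1 + Ste * (A / 2 + B / 3)) = Ste * (A + 2 * B)"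
          "2 * Bi * z' * (1 - A - B) = A + 2 * B" "Ste * A\<^sup>2 = 2 * B"
        using P1_quadratic_solutionE[OF assms sol] by blast
      have "xi_min Ste Bi < z' \<and> z' < xi_max Ste Bi \<and> xi_quartic Ste Bi z' = 0 \<and>
          A = coeff_A1 Ste Bi z' \<and> B = coeff_B1 Ste Bi z'"
        using algebraic_system_iff[OF S Bi z', of A B] AB sys' by blast
      moreover from this have "z' = z" using ex1 z by blast
      ultimately show ?thesis using s T by (auto simp: quadratic_profile_def)
    qed
    show "?A > 0 \<and> ?B > 0 \<and>
        P1_quadratic_solution k \<rho> c lam \<Theta> h (quadratic_profile ?A ?B \<Theta> ?s) ?s \<and>
        (\<forall>T s. P1_quadratic_solution k \<rho> c lam \<Theta> h T s \<longrightarrow> (\<forall>t\<ge>0. s t = ?s t) \<and>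
          (\<forall>t>0. \<forall>x\<in>{0..?s t}. T x t = quadratic_profile ?A ?B \<Theta> ?s x t))"
      using P1_quadratic_solution_exists[OF assms z0 sys] sys(1,2) unique by blast
  qed
qed

end
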